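(* Let $\gamma$ be a convex closed curve in the Euclidean plane, with the origin $O$ of Euclidean coordinates $(x,y)$ inside it, and let $\Gamma$ be its dual curve. Let $\Phi(\sigma,v_x,v_y)$ be a homogeneous polynomial of even degree $n$ in $\sigma,v_x,v_y$ such that $\Phi(\sigma(v),v_x,v_y)$ is an integral of the Birkhoff billiard flow inside $\gamma$, vanishing on the tangent vectors to the boundary $\gamma$. Then the Angular billiard corresponding to $\Gamma$ is also integrable, with the integral of the form $$G(x,y)=\frac{F(x,y)}{(\sqrt{x^2+y^2})^{\,n}},\qquad F(x,y)=\Phi(1,-y,x),$$ where $F$ is a (non-homogeneous) polynomial of degree $n$. Moreover, $F$ vanishes on $\Gamma$.
   Context: Birkhoff billiard: let $\Omega$ be the domain bounded by $\gamma$. The billiard flow $g^t$ transports a tangent vector $v=(v_x,v_y)$ at $q=(x,y)\in\Omega$ parallel along the straight line in the direction of $v$ until collision with $\gamma$, where it is reflected by $v_+=v_--2\nu\langle v_-,\nu\rangle$, with $\nu$ the unit outward normal to $\gamma$. Here $\sigma(v)=xv_y-yv_x$ is the momentum of $v$ with respect to $O$. An integral is a function of $(q,v)$, considered on the energy level $\{|v|=1\}$, that is invariant under $g^t$. Duality: the line $\{\langle N,X\rangle=p\}$ with $|N|=1$, $p>0$, corresponds to the point $N/p$. The dual curve $\Gamma$ is the set of points dual to the tangent lines of $\gamma$; $O$ lies inside $\Gamma$. Angular billiard map of $\Gamma$: let $D$ be the convex domain bounded by $\Gamma$ (oriented counterclockwise), $O\in D$, $U=\mathbb{R}^2\setminus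 D$. For $A\in U$ take, of the two tangent lines from $A$ to $\Gamma$, the right one as seen from $A$ looking at $\Gamma$ (the one which agrees with the orientation of $\Gamma$); let $T$ be its tangency point. Let $l_A$ be the line through $O$ symmetric to the line $OA$ with respect to the line $OT$ ($l_A=OA$ if $OA\perp OT$). Let $\mathcal{S}=\{A\in U: l_A\parallel AT\}$. For $A\in U\setminus\mathcal{S}$, $\mathcal{A}(A)$ is the intersection point of $l_A$ with the tangent line $AT$ ($\mathcal{A}(A)=A$ if $OA\perp OT$). The Angular billiard is called integrable, with integral $G:U\setminus\mathcal{S}\to\mathbb{R}$, if $G(A)=G(\mathcal{A}(A))$ for all $A\in U\setminus\mathcal{S}$.
   Formalization: "F is a polynomial of degree n" is read as degree at most n, with equality when σ does not divide Φ; exact degree n fails e.g. for the unit circle with Φ = σ²(σ² − v_x² − v_y²), where n = 4 but F = 1 − x² − y². *)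

theory Defs
  imports "HOL-Analysis.Analysis" "HOL-Library.Poly_Mapping"
begin

text \<open>The Euclidean plane is the type \<^typ>\<open>complex\<close>: the point \<open>(x,y)\<close> has \<open>x = Re\<close>, \<open>y = Im\<close>,
  and \<^term>\<open>(\<bullet>)\<close> is the standard scalar product.\<close>

definition cross :: "complex \<Rightarrow> complex \<Rightarrow> real" where
  "cross a b = Re a * Im b - Im a * Re b"

subsection \<open>Polynomials in two and three variables\<close>

definition eval3 :: "(nat \<times> nat \<times> nat \<Rightarrow>\<^sub>0 real) \<Rightarrow> real \<Rightarrow> real \<Rightarrow> real \<Rightarrow> real" where
  "eval3 \<Phi> s a b = (\<Sum>(i, j, k) \<in> Poly_Mapping.keys \<Phi>. Poly_Mapping.lookup \<Phi> (i, j, k) * s ^ i * a ^ j * b ^ k)"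

definition eval2 :: "(nat \<times> nat \<Rightarrow>\<^sub>0 real) \<Rightarrow> real \<Rightarrow> real \<Rightarrow> real" where
  "eval2 F x y = (\<Sum>(i, j) \<in> Poly_Mapping.keys F. Poly_Mapping.lookup F (i, j) * x ^ i * y ^ j)"

text \<open>As usual, the zero polynomial counts as homogeneous of every degree.\<close>
definition homogeneous3 :: "nat \<Rightarrow> (nat \<times> nat \<times> nat \<Rightarrow>\<^sub>0 real) \<Rightarrow> bool" where
  "homogeneous3 n \<Phi> \<longleftrightarrow> (\<forall>(i, j, k) \<in> Poly_Mapping.keys \<Phi>. i + j + k = n)"

text \<open>The zero polynomial gets total degree \<open>0\<close>.\<close>
definition total_degree2 :: "(nat \<times> nat \<Rightarrow>\<^sub>0 real) \<Rightarrow> nat" where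
  "total_degree2 F = Max (insert 0 ((\<lambda>(i, j). i + j) ` Poly_Mapping.keys F))"

text \<open>The first variable does not divide \<open>\<Phi>\<close>, i.e.\ some monomial of \<open>\<Phi>\<close> does not involve it.\<close>
definition fst_var_not_dvd3 :: "(nat \<times> nat \<times> nat \<Rightarrow>\<^sub>0 real) \<Rightarrow> bool" where
  "fst_var_not_dvd3 \<Phi> \<longleftrightarrow> (\<exists>j k. (0, j, k) \<in> Poly_Mapping.keys \<Phi>)"

subsection \<open>Convex closed curves and their tangents\<close>

text \<open>A regular simple closed \<open>C\<^sup>1\<close> curve bounding a convex domain, parametrised
  \<open>1\<close>-periodically so that the tangents at both ends of \<open>[0,1]\<close> agree. Strict convexity is not
  required.\<close>
definition convex_closed_curve :: "(real \<Rightarrow> complex) \<Rightarrow> bool" where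
  "convex_closed_curve \<gamma> \<longleftrightarrow>
     simple_path \<gamma> \<and> (\<forall>t. \<gamma> (t + 1) = \<gamma> t) \<and>
     \<gamma> C1_differentiable_on UNIV \<and> (\<forall>t. vector_derivative \<gamma> (at t) \<noteq> 0) \<and>
     convex (inside (path_image \<gamma>))"

definition tangent_line :: "(real \<Rightarrow> complex) \<Rightarrow> real \<Rightarrow> complex set" where
  "tangent_line \<gamma> t = {\<gamma> t + s *\<^sub>R vector_derivative \<gamma> (at t) |s. True}"

definition outward_normal :: "(real \<Rightarrow> complex) \<Rightarrow> complex \<Rightarrow> complex \<Rightarrow> bool" where
  "outward_normal \<gamma> q \<nu> \<longleftrightarrow>
     (\<exists>t. q = \<gamma> t \<and> norm \<nu> = 1 \<and> \<nu> \<bullet> vector_derivative \<gamma> (at t) = 0 \<and>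
       (\<forall>\<^sub>F s in at_right 0. q + s *\<^sub>R \<nu> \<in> outside (path_image \<gamma>)))"

subsection \<open>Birkhoff billiard\<close>

definition momentum :: "complex \<Rightarrow> complex \<Rightarrow> real" where
  "momentum q v = Re q * Im v - Im q * Re v"

text \<open>\<open>billiard_flow \<gamma> t q v q' v'\<close> means \<open>g\<^sup>t(q,v) = (q',v')\<close>, for \<open>t \<ge> 0\<close>. Besides vectors at
  interior points, the relation involves reflected vectors at points of \<open>\<gamma>\<close>, from which the motion
  continues after a collision.\<close>
inductive billiard_flow ::
  "(real \<Rightarrow> complex) \<Rightarrow> real \<Rightarrow> complex \<Rightarrow> complex \<Rightarrow> complex \<Rightarrow> complex \<Rightarrow> bool" for \<gamma>
where
  free: "\<lbrakk>0 \<le> t; \<forall>s. 0 < s \<and> s \<le> t \<longrightarrow> q + s *\<^sub>R v \<in> inside (path_image \<gamma>)\<rbrakk>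
    \<Longrightarrow> billiard_flow \<gamma> t q v (q + t *\<^sub>R v) v"
| collision: "\<lbrakk>0 < \<tau>; \<forall>s. 0 < s \<and> s < \<tau> \<longrightarrow> q + s *\<^sub>R v \<in> inside (path_image \<gamma>);
     q + \<tau> *\<^sub>R v \<in> path_image \<gamma>; outward_normal \<gamma> (q + \<tau> *\<^sub>R v) \<nu>;
     billiard_flow \<gamma> t (q + \<tau> *\<^sub>R v) (v - (2 * (v \<bullet> \<nu>)) *\<^sub>R \<nu>) q' v'\<rbrakk>
    \<Longrightarrow> billiard_flow \<gamma> (\<tau> + t) q v q' v'"

text \<open>Invariance under \<open>g\<^sup>t\<close> with \<open>t \<ge> 0\<close> includes invariance under the inverses \<open>g\<^sup>-\<^sup>t\<close>.\<close>
definition billiard_integral :: "(real \<Rightarrow> complex) \<Rightarrow> (complex \<Rightarrow> complex \<Rightarrow> real) \<Rightarrow> bool" where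
  "billiard_integral \<gamma> f \<longleftrightarrow>
     (\<forall>t q v q' v'. q \<in> inside (path_image \<gamma>) \<and> norm v = 1 \<and> q' \<in> inside (path_image \<gamma>) \<and>
        billiard_flow \<gamma> t q v q' v' \<longrightarrow> f q' v' = f q v)"

definition vanishes_on_tangents :: "(real \<Rightarrow> complex) \<Rightarrow> (complex \<Rightarrow> complex \<Rightarrow> real) \<Rightarrow> bool" where
  "vanishes_on_tangents \<gamma> f \<longleftrightarrow>
     (\<forall>t v. norm v = 1 \<and> v \<in> span {vector_derivative \<gamma> (at t)} \<longrightarrow> f (\<gamma> t) v = 0)"

subsection \<open>Dual curve\<close>

definition dual_curve :: "(real \<Rightarrow> complex) \<Rightarrow> complex set" where
  "dual_curve \<gamma> =
     {(1 / p) *\<^sub>R N |N p t. norm N = 1 \<and> 0 < p \<and> tangent_line \<gamma> t = {X. N \<bullet> X = p}}"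

subsection \<open>Angular billiard\<close>

text \<open>In this section \<open>\<Gamma>\<close> is the trace of a closed convex curve, \<open>D = inside \<Gamma>\<close> and \<open>U = - D\<close>
  (so \<open>\<Gamma> \<subseteq> U\<close>). The right tangent from \<open>A\<close> is the line through \<open>A\<close> with unit direction \<open>u\<close> that meets
  \<open>\<Gamma>\<close> at \<open>T\<close>, ahead of \<open>A\<close>, and has \<open>D\<close> on its left. If \<open>\<gamma>\<close> contains segments, \<open>\<Gamma>\<close> has corners, where
  tangent lines are supporting lines. For \<open>A \<in> \<Gamma>\<close> one gets \<open>T = A\<close>.\<close>
definition right_tangent :: "complex set \<Rightarrow> complex \<Rightarrow> complex \<Rightarrow> complex \<Rightarrow> bool" where
  "right_tangent \<Gamma> A u T \<longleftrightarrow>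
     norm u = 1 \<and> T \<in> \<Gamma> \<and> (\<exists>s\<ge>0. T = A + s *\<^sub>R u) \<and> (\<forall>P \<in> inside \<Gamma>. 0 \<le> cross u (P - A))"

text \<open>Orthogonal reflection of the plane in the line \<open>OT\<close>, for \<open>T \<noteq> 0\<close>.\<close>
definition line_reflection :: "complex \<Rightarrow> complex \<Rightarrow> complex" where
  "line_reflection T X = (2 * (X \<bullet> T) / (T \<bullet> T)) *\<^sub>R T - X"

text \<open>The line \<open>l\<^sub>A\<close>. If \<open>OA \<bottom> OT\<close>, reflection in \<open>OT\<close> maps the line \<open>OA\<close> to itself.\<close>
definition sym_line :: "complex \<Rightarrow> complex \<Rightarrow> complex set" where
  "sym_line A T = line_reflection T ` span {A}"

text \<open>The set \<open>S\<close>: since \<open>l\<^sub>A\<close> passes through \<open>O\<close>, it is parallel to the tangent iff it contains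
  the direction \<open>u\<close>.\<close>
definition singular_set :: "complex set \<Rightarrow> complex set" where
  "singular_set \<Gamma> = {A \<in> - inside \<Gamma>. \<exists>u T. right_tangent \<Gamma> A u T \<and> u \<in> sym_line A T}"

text \<open>At a corner \<open>A\<close> of \<open>\<Gamma>\<close> there are several directions \<open>u\<close>, but all of them give the point \<open>A\<close>.\<close>
definition angular_map :: "complex set \<Rightarrow> complex \<Rightarrow> complex" where
  "angular_map \<Gamma> A =
     (THE B. \<exists>u T. right_tangent \<Gamma> A u T \<and> B \<in> sym_line A T \<and> (\<exists>s. B = A + s *\<^sub>R u))"

definition angular_integral :: "complex set \<Rightarrow> (complex \<Rightarrow> real) \<Rightarrow> bool" where
  "angular_integral \<Gamma> G \<longleftrightarrow>
     (\<forall>A \<in> - inside \<Gamma> - singular_set \<Gamma>. G A = G (angular_map \<Gamma> A))"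

end

theory Submission
  imports Defs
begin

text \<open>
  Polar duality between points and lines turns the Birkhoff billiard in \<open>\<gamma>\<close> into the angular
  billiard of \<open>\<Gamma>\<close>. Let \<open>K\<close> be the closed region bounded by \<open>\<gamma>\<close>. Every tangent line of \<open>\<gamma>\<close>
  supports \<open>K\<close>, so \<open>\<Gamma>\<close> is the boundary of the polar body \<open>{Y. \<forall>X\<in>K. Y \<bullet> X \<le> 1}\<close>
  (\<open>dual_curve_eq\<close>). A point \<open>A\<close> outside \<open>\<Gamma>\<close> is dual to the line \<open>{X. A \<bullet> X = 1}\<close>, which meets
  \<open>K\<close> and has direction \<open>\<i> * A\<close>. The right tangent from \<open>A\<close>, which touches \<open>\<Gamma>\<close> at \<open>T\<close>, is dual
  to one end \<open>Q\<close> of the chord cut out by that line, and \<open>{X. T \<bullet> X = 1}\<close> is the tangent line of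
  \<open>\<gamma>\<close> at \<open>Q\<close> (\<open>right_tangent_dual\<close>). A particle that moves along the chord reaches \<open>Q\<close> and is
  reflected in the tangent line there, whose normal is \<open>T\<close>. A quarter turn converts this into the
  reflection of \<open>A\<close> in the line \<open>OT\<close> (\<open>reflect_ii\<close>), and the reflected line, which still passes
  through \<open>Q\<close>, is dual to the point \<open>B\<close> of \<open>l\<^sub>A\<close> with \<open>B \<bullet> Q = 1\<close>. This \<open>B\<close> is the image of
  \<open>A\<close> under the angular billiard map (\<open>angular_map_dual\<close>).

  For a unit vector \<open>v\<close> along the line dual to \<open>A\<close> the momentum is \<open>\<plusminus> 1 / |A|\<close>, so homogeneity of
  even degree gives \<open>\<Phi>(\<sigma>(v), v) = \<Phi>(1, - y, x) / |A|\<^sup>n = G(A)\<close> with \<open>A = (x, y)\<close>. Invariance of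
  \<open>\<Phi>\<close> under one collision at \<open>Q\<close> (\<open>reflection_invariance\<close>) is therefore the equation
  \<open>G(A) = G(B)\<close>. If \<open>A \<in> \<Gamma>\<close>, the line dual to \<open>A\<close> is tangent to \<open>\<gamma>\<close>, so \<open>F(A) = 0\<close>.

  The angular billiard map is defined by a definite description, so existence and uniqueness of the
  right tangent matter too. Existence comes from taking an extreme point of the chord
  (\<open>right_tangent_ex\<close>). Smoothness of \<open>\<gamma>\<close> makes \<open>\<Gamma>\<close> strictly convex, so that \<open>Q\<close> determines
  \<open>T\<close> (\<open>polar_functional_unique\<close>).
\<close>

section \<open>Polar bodies\<close>

definition polar :: "'a::real_inner set \<Rightarrow> 'a set" where
  "polar S = {Y. \<forall>X\<in>S. Y \<bullet> X \<le> 1}"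

lemma polarD: "Y \<in> polar S \<Longrightarrow> X \<in> S \<Longrightarrow> Y \<bullet> X \<le> 1"
  by (simp add: polar_def)

lemma polar_eq_INT: "polar S = (\<Inter>X\<in>S. {Y. X \<bullet> Y \<le> 1})"
  by (auto simp: polar_def inner_commute)

lemma convex_polar: "convex (polar S)"
  unfolding polar_eq_INT by (auto intro!: convex_INT convex_halfspace_le)

lemma closed_polar: "closed (polar S)"
  unfolding polar_eq_INT by (auto intro!: closed_INT closed_halfspace_le)

lemma bounded_polar:
  assumes "0 \<in> interior S"
  shows "bounded (polar S)"
proof -
  obtain e where e: "0 < e" "cball 0 e \<subseteq> S"
    using assms mem_interior_cball by blast
  have "norm Y \<le> 1 / e" if "Y \<in> polar S" for Y
  proof (cases "Y = 0")
    case False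
    have "(e / norm Y) *\<^sub>R Y \<in> S"
      using e False by (auto intro!: subsetD[OF e(2)])
    then have "Y \<bullet> ((e / norm Y) *\<^sub>R Y) \<le> 1"
      using that polarD by blast
    then have "e * norm Y \<le> 1"
      using False by (simp add: dot_square_norm power2_eq_square)
    then show ?thesis
      using e by (simp add: field_simps)
  qed (use e in simp)
  then show ?thesis
    by (auto simp: bounded_iff)
qed

lemma polar_less_1_interior:
  assumes "Y \<in> polar S" "X \<in> interior S"
  shows "Y \<bullet> X < 1"
proof (cases "Y = 0")
  case False
  obtain e where e: "0 < e" "cball X e \<subseteq> S"
    using assms mem_interior_cball by blast
  have "X + (e / norm Y) *\<^sub>R Y \<in> S"
    using e False by (auto intro!: subsetD[OF e(2)] simp: dist_norm)
  then have "Y \<bullet> (X + (e / norm Y) *\<^sub>R Y) \<le> 1"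
    using assms polarD by blast
  then have "Y \<bullet> X + e * norm Y \<le> 1"
    using False by (simp add: inner_add_right dot_square_norm power2_eq_square)
  moreover have "0 < e * norm Y"
    using e False by simp
  ultimately show ?thesis by linarith
qed simp

text \<open>Compactness is what turns strict inequality at each point of \<open>S\<close> into a uniform gap, which
  leaves room for a ball around \<open>Y\<close>.\<close>
lemma interior_polar:
  fixes S :: "'a::real_inner set"
  assumes "compact S" "S \<noteq> {}"
  shows "interior (polar S) = {Y. \<forall>X\<in>S. Y \<bullet> X < 1}"
proof (intro subset_antisym subsetI)
  fix Y assume Y: "Y \<in> interior (polar S)"
  have "Y \<bullet> X < 1" if "X \<in> S" for X
  proof -
    have "X \<in> polar (polar S)"
      using that by (auto simp: polar_def inner_commute)
    then show ?thesis
      using polar_less_1_interior Y by (metis inner_commute)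
  qed
  then show "Y \<in> {Y. \<forall>X\<in>S. Y \<bullet> X < 1}" by simp
next
  fix Y assume "Y \<in> {Y. \<forall>X\<in>S. Y \<bullet> X < 1}"
  then have Y: "Y \<bullet> X < 1" if "X \<in> S" for X
    using that by blast
  have "continuous_on S (\<lambda>X. Y \<bullet> X)"
    by (intro continuous_intros)
  then obtain X0 where X0: "X0 \<in> S" "\<And>X. X \<in> S \<Longrightarrow> Y \<bullet> X \<le> Y \<bullet> X0"
    using continuous_attains_sup[OF assms] by blast
  obtain b where b: "0 < b" "\<And>X. X \<in> S \<Longrightarrow> norm X \<le> b"
    using compact_imp_bounded[OF assms(1)] bounded_pos by blast
  define d where "d = (1 - Y \<bullet> X0) / b"
  have "0 < d"
    using Y[OF X0(1)] b by (simp add: d_def)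
  moreover have "ball Y d \<subseteq> polar S"
  proof
    fix Z assume "Z \<in> ball Y d"
    then have Z: "norm (Z - Y) \<le> d"
      by (simp add: dist_norm norm_minus_commute)
    have "Z \<bullet> X \<le> 1" if "X \<in> S" for X
    proof -
      have "(Z - Y) \<bullet> X \<le> norm (Z - Y) * norm X"
        by (rule norm_cauchy_schwarz)
      also have "\<dots> \<le> d * b"
        using Z b that \<open>0 < d\<close> by (intro mult_mono) auto
      also have "\<dots> = 1 - Y \<bullet> X0"
        using b by (simp add: d_def)
      finally show ?thesis
        using X0(2)[OF that] by (simp add: inner_diff_left)
    qed
    then show "Z \<in> polar S"
      by (simp add: polar_def)
  qed
  ultimately show "Y \<in> interior (polar S)"
    using mem_interior by blast
qed

lemma frontier_polar:
  fixes S :: "'a::real_inner set"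
  assumes "compact S" "S \<noteq> {}"
  shows "frontier (polar S) = {Y \<in> polar S. \<exists>X\<in>S. Y \<bullet> X = 1}"
  unfolding frontier_def interior_polar[OF assms] closure_closed[OF closed_polar]
  by (force simp: polar_def)

text \<open>A functional that strictly separates \<open>X\<close> from the compact set \<open>S\<close> can be normalised to lie in the
  interior of the polar body. So this form of the bipolar theorem needs the inequality on the
  interior only, which fits right tangents: they are defined through the open domain inside the
  dual curve.\<close>
lemma mem_if_le_1_on_interior_polar:
  fixes S :: "'a::euclidean_space set"
  assumes "compact S" "convex S" "0 \<in> S"
    and le: "\<And>Y. Y \<in> interior (polar S) \<Longrightarrow> Y \<bullet> X \<le> 1"
  shows "X \<in> S"
proof (rule ccontr)
  assume "X \<notin> S"
  then obtain a b where ab: "a \<bullet> X < b" "\<And>x. x \<in> S \<Longrightarrow> a \<bullet> x > b"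
    using separating_hyperplane_closed_point assms compact_imp_closed by metis
  have "b < 0"
    using ab(2)[OF assms(3)] by simp
  have "(1 / b) *\<^sub>R a \<in> interior (polar S)"
    using ab \<open>b < 0\<close> assms by (subst interior_polar) (auto simp: divide_simps)
  from le[OF this] show False
    using ab \<open>b < 0\<close> by (auto simp: divide_simps)
qed

text \<open>This form of the separation theorem serves both for the supporting line at a boundary point
  (\<open>C\<close> is the point) and for the tangent cone there (\<open>C\<close> is a ray). The separating functional
  can be normalised to the value \<open>1\<close> because \<open>0\<close> is an interior point of \<open>S\<close>.\<close>
lemma polar_separates:
  fixes S :: "'a::euclidean_space set"
  assumes "convex S" "0 \<in> interior S" "convex C" "C \<noteq> {}" "interior S \<inter> C = {}"
  obtains Y where "Y \<in> polar S" "\<And>X. X \<in> C \<Longrightarrow> 1 \<le> Y \<bullet> X"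
proof -
  obtain a b where ab: "a \<noteq> 0" "\<And>x. x \<in> interior S \<Longrightarrow> a \<bullet> x \<le> b" "\<And>x. x \<in> C \<Longrightarrow> b \<le> a \<bullet> x"
    using separating_hyperplane_sets[of "interior S" C] assms by (metis convex_interior empty_iff)
  obtain e where e: "0 < e" "cball 0 e \<subseteq> interior S"
    using assms(2) open_interior open_contains_cball by metis
  have "(e / norm a) *\<^sub>R a \<in> interior S"
    using e ab(1) by (auto intro!: subsetD[OF e(2)])
  from ab(2)[OF this] have "e * norm a \<le> b"
    using ab(1) by (simp add: dot_square_norm power2_eq_square)
  moreover have "0 < e * norm a"
    using e ab(1) by simp
  ultimately have "0 < b" by linarith
  have "S \<subseteq> closure (interior S)"
    using assms closure_subset convex_closure_interior by fastforce
  also have "\<dots> \<subseteq> {x. a \<bullet> x \<le> b}"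
    using ab(2) by (intro closure_minimal) (auto simp: closed_halfspace_le)
  finally have "(1 / b) *\<^sub>R a \<in> polar S"
    using \<open>0 < b\<close> by (auto simp: polar_def divide_simps)
  moreover have "1 \<le> ((1 / b) *\<^sub>R a) \<bullet> X" if "X \<in> C" for X
    using ab(3)[OF that] \<open>0 < b\<close> by (simp add: divide_simps)
  ultimately show ?thesis
    using that by blast
qed

section \<open>Quarter turns and reflections of the plane\<close>

lemma orthogonal_iff_multiple_ii:
  assumes "b \<noteq> 0"
  shows "a \<bullet> b = 0 \<longleftrightarrow> (\<exists>s. a = s *\<^sub>R (\<i> * b))"
proof
  assume *: "a \<bullet> b = 0"
  define N where "N = (Re b)\<^sup>2 + (Im b)\<^sup>2"
  have n: "N \<noteq> 0"
    using assms complex_neq_0 less_irrefl unfolding N_def by metis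
  define s where "s = (Im a * Re b - Re a * Im b) / N"
  have "s * N = Im a * Re b - Re a * Im b"
    using n by (simp add: s_def)
  moreover have "Re a * Re b + Im a * Im b = 0"
    using * by (simp add: inner_complex_def)
  ultimately have "N * Re a = N * - (s * Im b)" "N * Im a = N * (s * Re b)"
    unfolding N_def by algebra+
  then have "Re a = - (s * Im b)" "Im a = s * Re b"
    using n by (simp_all only: mult_cancel_left) auto
  then have "a = s *\<^sub>R (\<i> * b)"
    by (simp add: complex_eq_iff)
  then show "\<exists>s. a = s *\<^sub>R (\<i> * b)" ..
qed (auto simp: inner_complex_def)

lemma cross_eq_inner: "cross u w = (\<i> * u) \<bullet> w"
  by (simp add: cross_def inner_complex_def)

lemma inner_mult_ii [simp]: "(\<i> * a) \<bullet> (\<i> * b) = a \<bullet> b"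
  by (simp add: inner_complex_def)

lemma inner_ii_self [simp]: "(\<i> * a) \<bullet> a = 0" "a \<bullet> (\<i> * a) = 0"
  by (simp_all add: inner_complex_def)

lemma line_reflection_scaleR: "line_reflection T (c *\<^sub>R X) = c *\<^sub>R line_reflection T X"
  by (simp add: line_reflection_def algebra_simps)

lemma sym_line_eq_span: "sym_line A T = span {line_reflection T A}"
  by (auto simp: sym_line_def span_singleton image_image line_reflection_scaleR)

lemma norm_line_reflection:
  assumes "T \<noteq> 0"
  shows "norm (line_reflection T X) = norm X"
proof -
  have "line_reflection T X \<bullet> line_reflection T X = X \<bullet> X"
    using assms by (simp add: line_reflection_def inner_diff_left inner_diff_right inner_commute)
  then show ?thesis
    by (simp add: norm_eq)
qed

text \<open>The billiard reflection in the line with normal \<open>T\<close> is the negative of the reflection in the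
  line \<open>OT\<close>, and a quarter turn anticommutes with the latter. The two signs cancel.\<close>
lemma reflect_ii:
  assumes "T \<noteq> 0"
  shows "\<i> * w - (2 * ((\<i> * w) \<bullet> T) / (T \<bullet> T)) *\<^sub>R T = \<i> * line_reflection T w"
proof -
  define N where "N = T \<bullet> T"
  have n: "N \<noteq> 0"
    using assms by (simp add: N_def)
  have N: "N = Re T * Re T + Im T * Im T"
    by (simp add: N_def inner_complex_def)
  define k l where "k = ((\<i> * w) \<bullet> T) / N" and "l = (w \<bullet> T) / N"
  have kl: "k * N = Re w * Im T - Im w * Re T" "l * N = Re w * Re T + Im w * Im T"
    using n by (simp_all add: k_def l_def inner_complex_def)
  have "N * (k * Re T) = N * (l * Im T - Im w)" "N * (k * Im T) = N * (Re w - l * Re T)"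
    using kl N by algebra+
  then have "k * Re T = l * Im T - Im w" "k * Im T = Re w - l * Re T"
    using n by (simp_all only: mult_cancel_left) auto
  then have "\<i> * w - (2 * k) *\<^sub>R T = \<i> * ((2 * l) *\<^sub>R T - w)"
    by (simp add: complex_eq_iff)
  then show ?thesis
    by (simp add: k_def l_def line_reflection_def N_def)
qed

section \<open>The dual polynomial\<close>

text \<open>The monomial \<open>s\<^sup>i a\<^sup>j b\<^sup>k\<close> of \<open>\<Phi>\<close> becomes \<open>(-1)\<^sup>j x\<^sup>k y\<^sup>j\<close>. Homogeneity recovers
  \<open>i\<close> from \<open>j\<close> and \<open>k\<close>, so different monomials do not merge. If \<open>k + j > n\<close>, the truncated
  subtraction gives \<open>i = 0\<close>, and \<open>(0, j, k)\<close> is not an exponent of a polynomial that is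
  homogeneous of degree \<open>n\<close>.\<close>
definition dual_poly :: "nat \<Rightarrow> (nat \<times> nat \<times> nat \<Rightarrow>\<^sub>0 real) \<Rightarrow> (nat \<times> nat \<Rightarrow>\<^sub>0 real)" where
  "dual_poly n \<Phi> = Poly_Mapping.mapp (\<lambda>(k, j) c. (- 1) ^ j * c)
     (Poly_Mapping.map_key (\<lambda>(k, j). (n - k - j, j, k)) \<Phi>)"

lemma lookup_dual_poly:
  "Poly_Mapping.lookup (dual_poly n \<Phi>) (k, j) = (- 1) ^ j * Poly_Mapping.lookup \<Phi> (n - k - j, j, k)"
proof -
  have "inj (\<lambda>(k, j). (n - k - j, j, k))"
    by (auto simp: inj_def)
  then show ?thesis
    by (simp add: in_keys_iff dual_poly_def lookup_mapp map_key.rep_eq when_def)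
qed

lemma keys_dual_poly:
  "(k, j) \<in> Poly_Mapping.keys (dual_poly n \<Phi>) \<longleftrightarrow> (n - k - j, j, k) \<in> Poly_Mapping.keys \<Phi>"
  by (simp add: in_keys_iff lookup_dual_poly)

lemma eval2_dual_poly:
  assumes "homogeneous3 n \<Phi>"
  shows "eval2 (dual_poly n \<Phi>) x y = eval3 \<Phi> 1 (- y) x"
proof -
  let ?h = "\<lambda>(k, j). (n - k - j, j, k)"
  have "bij_betw ?h (Poly_Mapping.keys (dual_poly n \<Phi>)) (Poly_Mapping.keys \<Phi>)"
  proof (rule bij_betwI[where g = "\<lambda>(i, j, k). (k, j)"])
    show "(\<lambda>(i, j, k). (k, j)) \<in> Poly_Mapping.keys \<Phi> \<rightarrow> Poly_Mapping.keys (dual_poly n \<Phi>)"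
      using assms by (fastforce simp: keys_dual_poly homogeneous3_def)
    show "?h ((\<lambda>(i, j, k). (k, j)) z) = z" if "z \<in> Poly_Mapping.keys \<Phi>" for z
      using assms that by (fastforce simp: homogeneous3_def)
  qed (auto simp: keys_dual_poly)
  then have "eval3 \<Phi> 1 (- y) x = (\<Sum>z\<in>Poly_Mapping.keys (dual_poly n \<Phi>).
      (case ?h z of (i, j, k) \<Rightarrow> Poly_Mapping.lookup \<Phi> (i, j, k) * 1 ^ i * (- y) ^ j * x ^ k))"
    unfolding eval3_def by (rule sum.reindex_bij_betw[symmetric])
  also have "\<dots> = eval2 (dual_poly n \<Phi>) x y"
    unfolding eval2_def
  proof (intro sum.cong refl, clarify)
    fix k j
    have "(- y) ^ j = (- 1) ^ j * y ^ j"
      by (rule power_minus)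
    then show "Poly_Mapping.lookup \<Phi> (n - k - j, j, k) * 1 ^ (n - k - j) * (- y) ^ j * x ^ k =
          Poly_Mapping.lookup (dual_poly n \<Phi>) (k, j) * x ^ k * y ^ j"
      by (simp add: lookup_dual_poly)
  qed
  finally show ?thesis ..
qed

lemma total_degree2_dual_poly:
  assumes "homogeneous3 n \<Phi>"
  shows "total_degree2 (dual_poly n \<Phi>) \<le> n"
    and "fst_var_not_dvd3 \<Phi> \<Longrightarrow> total_degree2 (dual_poly n \<Phi>) = n"
proof -
  have le: "k + j \<le> n" if "(k, j) \<in> Poly_Mapping.keys (dual_poly n \<Phi>)" for k j
    using that assms by (fastforce simp: keys_dual_poly homogeneous3_def)
  show *: "total_degree2 (dual_poly n \<Phi>) \<le> n"
    unfolding total_degree2_def using le by auto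
  assume "fst_var_not_dvd3 \<Phi>"
  then obtain j k where jk: "(0, j, k) \<in> Poly_Mapping.keys \<Phi>"
    by (auto simp: fst_var_not_dvd3_def)
  then have "j + k = n"
    using assms by (fastforce simp: homogeneous3_def)
  then have "(k, j) \<in> Poly_Mapping.keys (dual_poly n \<Phi>)" 
    using jk by (auto simp: keys_dual_poly)
  then have "k + j \<in> insert 0 ((\<lambda>(i, j). i + j) ` Poly_Mapping.keys (dual_poly n \<Phi>))"
    by force
  then have "n \<le> total_degree2 (dual_poly n \<Phi>)"
    unfolding total_degree2_def using \<open>j + k = n\<close> by (intro Max_ge) (auto simp: add.commute)
  with * show "total_degree2 (dual_poly n \<Phi>) = n" by simp
qed

lemma eval3_homogeneous:
  assumes "homogeneous3 n \<Phi>"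
  shows "eval3 \<Phi> (c * s) (c * a) (c * b) = c ^ n * eval3 \<Phi> s a b"
  unfolding eval3_def sum_distrib_left
proof (intro sum.cong refl, clarify)
  fix i j k assume "(i, j, k) \<in> Poly_Mapping.keys \<Phi>"
  then have "n = i + j + k"
    using assms by (fastforce simp: homogeneous3_def)
  then show "Poly_Mapping.lookup \<Phi> (i, j, k) * (c * s) ^ i * (c * a) ^ j * (c * b) ^ k =
      c ^ n * (Poly_Mapping.lookup \<Phi> (i, j, k) * s ^ i * a ^ j * b ^ k)"
    by (simp add: power_mult_distrib power_add)
qed

section \<open>The table and its polar body\<close>

locale billiard_table =
  fixes \<gamma> :: "real \<Rightarrow> complex"
  assumes curve: "convex_closed_curve \<gamma>"
    and zero_inside: "0 \<in> inside (path_image \<gamma>)"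
begin

definition table :: "complex set" where
  "table = closure (inside (path_image \<gamma>))"

lemma simple_closed: "simple_path \<gamma>" "pathfinish \<gamma> = pathstart \<gamma>"
proof -
  have "\<gamma> (0 + 1) = \<gamma> 0"
    using curve unfolding convex_closed_curve_def by blast
  then show "pathfinish \<gamma> = pathstart \<gamma>"
    by (simp add: pathfinish_def pathstart_def)
qed (use curve in \<open>simp add: convex_closed_curve_def\<close>)

lemma table_is_convex_body:
  shows interior_table: "interior table = inside (path_image \<gamma>)"
    and frontier_table: "frontier table = path_image \<gamma>"
    and compact_table: "compact table"
    and convex_table: "convex table"
    and zero_interior_table: "0 \<in> interior table"
proof -
  have J: "open (inside (path_image \<gamma>))" "bounded (inside (path_image \<gamma>))"
    "frontier (inside (path_image \<gamma>)) = path_image \<gamma>"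
    using Jordan_inside_outside[OF simple_closed] by auto
  have c: "convex (inside (path_image \<gamma>))"
    using curve by (simp add: convex_closed_curve_def)
  show i: "interior table = inside (path_image \<gamma>)"
    using c J by (simp add: table_def convex_interior_closure interior_open)
  show "frontier table = path_image \<gamma>"
    using i J by (simp add: table_def frontier_def interior_open)
  show "compact table" "convex table"
    using J c by (simp_all add: table_def compact_closure convex_closure)
  show "0 \<in> interior table"
    using i zero_inside by simp
qed

lemma table_nonempty: "table \<noteq> {}" "0 \<in> table"
  using zero_interior_table interior_subset by auto

lemma curve_subset_table: "path_image \<gamma> \<subseteq> table"
  using frontier_table compact_table by (metis compact_imp_closed frontier_subset_closed)

lemma outside_if_not_table: "X \<notin> table \<Longrightarrow> X \<in> outside (path_image \<gamma>)"
  using curve_subset_table interior_table interior_subset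
  by (metis UnE inside_outside ComplI in_mono union_with_outside Un_iff union_with_inside
      Compl_iff outside_inside)

lemma curve_in_path_image: "\<gamma> t \<in> path_image \<gamma>"
proof -
  have per: "\<gamma> (t + 1) = \<gamma> t" for t
    using curve unfolding convex_closed_curve_def by blast
  have shift: "\<gamma> (t + real_of_int k) = \<gamma> t" for t k
  proof (induction k rule: int_induct[where k = 0])
    case (step1 i)
    then show ?case using per[of "t + of_int i"] by (simp add: algebra_simps)
  next
    case (step2 i)
    then show ?case using per[of "t + of_int (i - 1)"] by (simp add: algebra_simps)
  qed simp
  have "\<gamma> t = \<gamma> (frac t)"
    using shift[of "frac t" "\<lfloor>t\<rfloor>"] by (simp add: frac_def)
  then show ?thesis
    unfolding path_image_def using frac_ge_0 frac_lt_1 by (metis atLeastAtMost_iff image_eqI less_imp_le)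
qed

lemma tangent_nonzero: "vector_derivative \<gamma> (at t) \<noteq> 0"
  using curve by (simp add: convex_closed_curve_def)

lemma curve_has_vector_derivative: "(\<gamma> has_vector_derivative vector_derivative \<gamma> (at t)) (at t)"
  using curve by (simp add: convex_closed_curve_def C1_differentiable_on_eq vector_derivative_works)

text \<open>The functional \<open>Y\<close> attains its maximum over the table at \<open>\<gamma> t\<close>.\<close>
lemma polar_orthogonal_tangent:
  assumes "Y \<in> polar table" "Y \<bullet> \<gamma> t = 1"
  shows "Y \<bullet> vector_derivative \<gamma> (at t) = 0"
proof (rule DERIV_local_max[where d = 1])
  have "((\<lambda>s. Y \<bullet> \<gamma> s) has_vector_derivative Y \<bullet> vector_derivative \<gamma> (at t)) (at t)"
    by (rule bounded_linear.has_vector_derivative[OF bounded_linear_inner_right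
          curve_has_vector_derivative])
  then show "((\<lambda>s. Y \<bullet> \<gamma> s) has_real_derivative Y \<bullet> vector_derivative \<gamma> (at t)) (at t)"
    by (simp add: has_real_derivative_iff_has_vector_derivative)
  show "\<forall>s. \<bar>t - s\<bar> < 1 \<longrightarrow> Y \<bullet> \<gamma> s \<le> Y \<bullet> \<gamma> t"
    using assms polarD curve_in_path_image curve_subset_table by (metis subsetD)
qed simp

lemma tangent_line_eq:
  assumes "Y \<in> polar table" "Y \<bullet> \<gamma> t = 1"
  shows "tangent_line \<gamma> t = {X. Y \<bullet> X = 1}"
proof -
  let ?d = "vector_derivative \<gamma> (at t)"
  have o: "Y \<bullet> ?d = 0" by (rule polar_orthogonal_tangent[OF assms])
  have "Y \<noteq> 0" using assms by auto
  have "?d \<bullet> Y = 0" using o by (simp add: inner_commute)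
  then obtain c where c: "?d = c *\<^sub>R (\<i> * Y)"
    using orthogonal_iff_multiple_ii[OF \<open>Y \<noteq> 0\<close>] by blast
  have "c \<noteq> 0" using tangent_nonzero c by (metis scaleR_zero_left)
  have "X \<in> tangent_line \<gamma> t" if X: "Y \<bullet> X = 1" for X
  proof -
    have "Y \<bullet> (X - \<gamma> t) = 0"
      using X assms(2) by (simp add: inner_diff_right)
    then have "(X - \<gamma> t) \<bullet> Y = 0"
      by (simp add: inner_commute)
    then obtain s where s: "X - \<gamma> t = s *\<^sub>R (\<i> * Y)"
      using orthogonal_iff_multiple_ii[OF \<open>Y \<noteq> 0\<close>] by blast
    have "X - \<gamma> t = (s / c) *\<^sub>R ?d"
      unfolding c s using \<open>c \<noteq> 0\<close> by simp
    then have "X = \<gamma> t + (s / c) *\<^sub>R ?d" by (simp add: algebra_simps)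
    then show ?thesis unfolding tangent_line_def by blast
  qed
  then show ?thesis
    using o assms(2) by (auto simp: tangent_line_def inner_add_right)
qed

lemma mem_curve_if_functional_1:
  assumes "Q \<in> table" "Y \<in> polar table" "Y \<bullet> Q = 1"
  shows "Q \<in> path_image \<gamma>"
  using polar_less_1_interior[OF assms(2), of Q] assms closure_subset
  by (auto simp flip: frontier_table simp: frontier_def)

text \<open>A regular \<open>C\<^sup>1\<close> curve has only one supporting line at each point. Dually, a supporting line
  of the polar body touches it at one point only.\<close>
lemma polar_functional_unique:
  assumes "Q \<in> table" "Y \<in> polar table" "Y \<bullet> Q = 1" "Z \<in> polar table" "Z \<bullet> Q = 1"
  shows "Y = Z"
proof -
  obtain t where Q: "Q = \<gamma> t"
    using mem_curve_if_functional_1[OF assms(1-3)] unfolding path_image_def by blast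
  let ?d = "vector_derivative \<gamma> (at t)"
  have Y: "Y \<bullet> ?d = 0" "Z \<bullet> ?d = 0"
    using polar_orthogonal_tangent assms Q by auto
  obtain y z where yz: "Y = y *\<^sub>R (\<i> * ?d)" "Z = z *\<^sub>R (\<i> * ?d)"
    using Y orthogonal_iff_multiple_ii[OF tangent_nonzero] by metis
  have "y * ((\<i> * ?d) \<bullet> Q) = 1" "z * ((\<i> * ?d) \<bullet> Q) = 1"
    using assms yz by simp_all
  then have "y = z" by algebra
  with yz show ?thesis by simp
qed

lemma support_ex:
  assumes "Q \<in> path_image \<gamma>"
  obtains Y where "Y \<in> polar table" "Y \<bullet> Q = 1"
proof -
  have Q: "Q \<in> table" "Q \<notin> interior table"
    using assms curve_subset_table frontier_table by (auto simp: frontier_def)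
  obtain Y where Y: "Y \<in> polar table" "\<And>X. X \<in> {Q} \<Longrightarrow> 1 \<le> Y \<bullet> X"
    by (rule polar_separates[OF convex_table zero_interior_table, of "{Q}"]) (use Q in auto)
  then show ?thesis
    using that polarD[OF Y(1) Q(1)] by force
qed

text \<open>The tangent line at \<open>\<gamma> t\<close> is the level line of a functional that supports the table there, since
  such a functional exists and vanishes on the tangent vector. Therefore the points dual to tangent
  lines are the functionals in the polar body that reach the value \<open>1\<close> on the table.\<close>
lemma dual_curve_eq: "dual_curve \<gamma> = frontier (polar table)"
proof (intro subset_antisym subsetI)
  fix Y assume "Y \<in> dual_curve \<gamma>"
  then obtain N p t where Y: "Y = (1 / p) *\<^sub>R N" "norm N = 1" "0 < p"
    "tangent_line \<gamma> t = {X. N \<bullet> X = p}"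
    unfolding dual_curve_def by blast
  have Y1: "tangent_line \<gamma> t = {X. Y \<bullet> X = 1}"
    using Y by (auto simp: divide_simps)
  obtain Z where Z: "Z \<in> polar table" "Z \<bullet> \<gamma> t = 1"
    using support_ex curve_in_path_image by blast
  have eq: "Y \<bullet> X = 1 \<longleftrightarrow> Z \<bullet> X = 1" for X
    using Y1 tangent_line_eq[OF Z] by blast
  (* Two linear functionals with the same level line of value 1 coincide: evaluate Y along the
     level line of Z. *)
  have "Z \<noteq> 0" using Z by auto
  then have Z1: "Z \<bullet> ((1 / (Z \<bullet> Z)) *\<^sub>R Z + s *\<^sub>R (\<i> * Z)) = 1" for s
    by (simp add: inner_add_right)
  have a: "Y \<bullet> ((1 / (Z \<bullet> Z)) *\<^sub>R Z) + s * (Y \<bullet> (\<i> * Z)) = 1" for s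
    using iffD2[OF eq Z1[of s]] by (simp only: inner_add_right inner_scaleR_right)
  have b: "Y \<bullet> (\<i> * Z) = 0" "Y \<bullet> Z = Z \<bullet> Z"
    using a[of 0] a[of 1] \<open>Z \<noteq> 0\<close> by (simp_all add: divide_simps)
  have "(Y - Z) \<bullet> (\<i> * Z) = 0"
    using b by (simp add: inner_diff_left)
  moreover have "\<i> * Z \<noteq> 0" using \<open>Z \<noteq> 0\<close> by simp
  ultimately obtain s where s: "Y - Z = s *\<^sub>R (\<i> * (\<i> * Z))"
    using orthogonal_iff_multiple_ii by blast
  have "(Y - Z) \<bullet> Z = 0" using b by (simp add: inner_diff_left)
  then have "s = 0" using \<open>Z \<noteq> 0\<close> unfolding s by simp
  then have "Y = Z" using s by simp
  then show "Y \<in> frontier (polar table)"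
    using Z curve_in_path_image[of t] curve_subset_table
    by (auto simp: frontier_polar[OF compact_table table_nonempty(1)])
next
  fix Y assume "Y \<in> frontier (polar table)"
  then obtain Q where Y: "Y \<in> polar table" "Q \<in> table" "Y \<bullet> Q = 1"
    by (auto simp: frontier_polar[OF compact_table table_nonempty(1)])
  then obtain t where Q: "Q = \<gamma> t"
    using mem_curve_if_functional_1[OF Y(2,1,3)] by (auto simp: path_image_def)
  have "Y \<noteq> 0" using Y by auto
  have "tangent_line \<gamma> t = {X. ((1 / norm Y) *\<^sub>R Y) \<bullet> X = 1 / norm Y}"
    using tangent_line_eq[OF Y(1)] Y(3) Q \<open>Y \<noteq> 0\<close> by simp
  moreover have "norm ((1 / norm Y) *\<^sub>R Y) = 1" "0 < 1 / norm Y"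
    "Y = (1 / (1 / norm Y)) *\<^sub>R ((1 / norm Y) *\<^sub>R Y)"
    using \<open>Y \<noteq> 0\<close> by simp_all
  ultimately show "Y \<in> dual_curve \<gamma>"
    unfolding dual_curve_def by blast
qed

lemma dual_curve_iff: "Y \<in> dual_curve \<gamma> \<longleftrightarrow> Y \<in> polar table \<and> (\<exists>Q\<in>path_image \<gamma>. Y \<bullet> Q = 1)"
  unfolding dual_curve_eq frontier_polar[OF compact_table table_nonempty(1)]
  using mem_curve_if_functional_1 curve_subset_table by blast

lemma inside_dual_curve: "inside (dual_curve \<gamma>) = interior (polar table)"
  unfolding dual_curve_eq
  by (rule inside_frontier_eq_interior[OF bounded_polar[OF zero_interior_table] convex_polar])

lemma zero_inside_dual: "0 \<in> inside (dual_curve \<gamma>)"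
  unfolding inside_dual_curve interior_polar[OF compact_table table_nonempty(1)] by simp

section \<open>Right tangents of the dual curve\<close>

text \<open>The left half-plane of a right tangent contains \<open>0\<close> in its interior, so it has the form
  \<open>{P. P \<bullet> Q \<le> 1}\<close>. It contains the polar body, hence \<open>Q\<close> lies in the table by the bipolar
  theorem, and in fact on \<open>\<gamma>\<close> because \<open>T \<bullet> Q = 1\<close>.\<close>
lemma right_tangent_dual:
  assumes rt: "right_tangent (dual_curve \<gamma>) A u T"
  obtains Q where "Q \<in> path_image \<gamma>" "A \<bullet> Q = 1" "T \<bullet> Q = 1" "u = (1 / norm Q) *\<^sub>R (\<i> * Q)"
proof -
  obtain s where u: "norm u = 1" and T: "T \<in> dual_curve \<gamma>" "T = A + s *\<^sub>R u" "0 \<le> s"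
    and left: "\<And>P. P \<in> inside (dual_curve \<gamma>) \<Longrightarrow> 0 \<le> (\<i> * u) \<bullet> (P - A)"
    using rt by (auto simp: right_tangent_def cross_eq_inner)
  have uu: "u \<bullet> u = 1" using u by (simp add: dot_square_norm)
  define c where "c = - ((\<i> * u) \<bullet> A)"
  (* 0 < c because a whole neighbourhood of 0 lies to the left of the tangent. *)
  have "open (inside (dual_curve \<gamma>))" by (simp add: inside_dual_curve)
  then obtain e where e: "0 < e" "cball 0 e \<subseteq> inside (dual_curve \<gamma>)"
    using zero_inside_dual open_contains_cball by blast
  have "- (e *\<^sub>R (\<i> * u)) \<in> inside (dual_curve \<gamma>)"
    using e u by (intro subsetD[OF e(2)]) (auto simp: norm_mult)
  from left[OF this] have "e \<le> c"
    using uu by (simp add: c_def inner_diff_right)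
  with e have "0 < c" by linarith
  define Q where "Q = - ((1 / c) *\<^sub>R (\<i> * u))"
  have Qin: "Q \<bullet> X = - (((\<i> * u) \<bullet> X) / c)" for X by (simp add: Q_def)
  have "Q \<in> table"
  proof (rule mem_if_le_1_on_interior_polar[OF compact_table convex_table table_nonempty(2)])
    fix P assume "P \<in> interior (polar table)"
    then have "0 \<le> (\<i> * u) \<bullet> P + c"
      using left[of P] by (simp add: inside_dual_curve c_def inner_diff_right)
    moreover have "(P \<bullet> Q) * c = - ((\<i> * u) \<bullet> P)"
      using \<open>0 < c\<close> Qin[of P] by (simp add: inner_commute[of P Q])
    ultimately have "(P \<bullet> Q) * c \<le> 1 * c"
      by linarith
    then show "P \<bullet> Q \<le> 1"
      using \<open>0 < c\<close> mult_le_cancel_right_pos by blast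
  qed
  moreover have AQ: "A \<bullet> Q = 1"
    using Qin[of A] \<open>0 < c\<close> by (simp add: inner_commute c_def)
  moreover have TQ: "T \<bullet> Q = 1"
    using AQ Qin[of u] by (simp add: T(2) inner_add_left inner_commute[of u Q])
  moreover have "norm Q = 1 / c"
    using u \<open>0 < c\<close> by (simp add: Q_def norm_mult)
  then have "u = (1 / norm Q) *\<^sub>R (\<i> * Q)"
    using \<open>0 < c\<close> by (simp add: Q_def scaleR_conv_of_real mult.assoc[symmetric])
  moreover have "Q \<in> path_image \<gamma>"
    using mem_curve_if_functional_1 \<open>Q \<in> table\<close> TQ T(1) dual_curve_iff by blast
  ultimately show ?thesis using that by blast
qed

lemma right_tangentI:
  assumes Q: "Q \<in> path_image \<gamma>" "A \<bullet> Q = 1" and T: "T \<in> polar table" "T \<bullet> Q = 1"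
    and s: "T = A + s *\<^sub>R (\<i> * Q)" "0 \<le> s"
  shows "right_tangent (dual_curve \<gamma>) A ((1 / norm Q) *\<^sub>R (\<i> * Q)) T"
  unfolding right_tangent_def
proof (intro conjI exI ballI)
  have "Q \<noteq> 0" using Q by auto
  then show "norm ((1 / norm Q) *\<^sub>R (\<i> * Q)) = 1" by (simp add: norm_mult)
  show "T \<in> dual_curve \<gamma>" using Q T dual_curve_iff by blast
  show "T = A + (s * norm Q) *\<^sub>R ((1 / norm Q) *\<^sub>R (\<i> * Q))" using s \<open>Q \<noteq> 0\<close> by simp
  show "0 \<le> s * norm Q" using s by simp
  fix P assume "P \<in> inside (dual_curve \<gamma>)"
  then have "P \<in> polar table" using inside_dual_curve interior_subset by blast
  then have "P \<bullet> Q \<le> 1" using Q(1) curve_subset_table polarD by blast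
  have "cross ((1 / norm Q) *\<^sub>R (\<i> * Q)) (P - A) = (1 - P \<bullet> Q) / norm Q"
    using Q(2) by (simp add: cross_def inner_complex_def divide_simps \<open>Q \<noteq> 0\<close>) (simp add: algebra_simps)
  then show "0 \<le> cross ((1 / norm Q) *\<^sub>R (\<i> * Q)) (P - A)"
    using \<open>P \<bullet> Q \<le> 1\<close> by simp
qed

text \<open>If \<open>A\<close> lies on \<open>\<Gamma>\<close>, take \<open>T = A\<close>. Otherwise the line dual to \<open>A\<close> cuts a chord out of the
  table, and the right tangent comes from the last point \<open>Q\<close> of this chord in the direction
  \<open>\<i> * A\<close>. At this end the supporting functional \<open>T\<close> increases along \<open>\<i> * A\<close>, which says that
  \<open>T\<close> lies ahead of \<open>A\<close>.\<close>
lemma right_tangent_ex: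
  assumes A: "A \<notin> inside (dual_curve \<gamma>)"
  obtains u T where "right_tangent (dual_curve \<gamma>) A u T"
proof (cases "A \<in> polar table")
  case True
  then obtain Q where Q: "Q \<in> table" "A \<bullet> Q = 1"
    using A unfolding inside_dual_curve interior_polar[OF compact_table table_nonempty(1)]
    using polarD[OF True] by force
  then have "Q \<in> path_image \<gamma>"
    using mem_curve_if_functional_1 True by blast
  then show ?thesis
    using right_tangentI[of Q A A 0] Q True that by simp
next
  case False
  then obtain X where X: "X \<in> table" "1 < A \<bullet> X"
    by (auto simp: polar_def not_le)
  have "A \<noteq> 0" using X by auto
  (* X2 is a point of the chord in the interior of the table: X shrunk towards O. *)
  define X2 where "X2 = (1 / (A \<bullet> X)) *\<^sub>R X"
  have AX2: "A \<bullet> X2 = 1" using X by (simp add: X2_def)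
  have "X - (1 - 1 / (A \<bullet> X)) *\<^sub>R (X - 0) \<in> interior table"
    using X closure_subset
    by (intro mem_interior_closure_convex_shrink[OF convex_table zero_interior_table]) auto
  then have X2: "X2 \<in> interior table" by (simp add: X2_def algebra_simps)
  define L where "L = table \<inter> {Y. A \<bullet> Y = 1}"
  have "compact L" unfolding L_def
    by (intro compact_Int_closed compact_table closed_hyperplane)
  moreover have "X2 \<in> L" using X2 AX2 interior_subset by (auto simp: L_def)
  moreover have "continuous_on L (\<lambda>Y. (\<i> * A) \<bullet> Y)" by (intro continuous_intros)
  ultimately obtain Q where Q: "Q \<in> L" "\<And>Y. Y \<in> L \<Longrightarrow> (\<i> * A) \<bullet> Y \<le> (\<i> * A) \<bullet> Q"
    using continuous_attains_sup[of L] by blast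
  have AA: "0 < A \<bullet> A" using \<open>A \<noteq> 0\<close> by simp
  have "Q \<notin> interior table"
  proof
    assume "Q \<in> interior table"
    then obtain e where e: "0 < e" "cball Q e \<subseteq> table"
      using mem_interior_cball by blast
    have "Q + (e / norm A) *\<^sub>R (\<i> * A) \<in> L"
      using e Q(1) \<open>A \<noteq> 0\<close>
      by (auto simp: L_def inner_add_right dist_norm norm_mult intro!: subsetD[OF e(2)])
    from Q(2)[OF this] have "(e / norm A) * (A \<bullet> A) \<le> 0"
      by (simp add: inner_add_right)
    moreover have "0 < (e / norm A) * (A \<bullet> A)" using e AA by simp
    ultimately show False by linarith
  qed
  then have Qc: "Q \<in> path_image \<gamma>"
    using Q(1) closure_subset by (auto simp: L_def frontier_def simp flip: frontier_table)
  then obtain T where T: "T \<in> polar table" "T \<bullet> Q = 1" using support_ex by blast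
  have AQ: "A \<bullet> Q = 1" using Q by (simp add: L_def)
  have "A \<bullet> (X2 - Q) = 0" using AQ AX2 by (simp add: inner_diff_right)
  then have "(X2 - Q) \<bullet> A = 0" by (simp add: inner_commute)
  then obtain r where r: "X2 - Q = r *\<^sub>R (\<i> * A)"
    using orthogonal_iff_multiple_ii[OF \<open>A \<noteq> 0\<close>] by blast
  have "(\<i> * A) \<bullet> (X2 - Q) \<le> 0" using Q(2)[OF \<open>X2 \<in> L\<close>] by (simp add: inner_diff_right)
  then have "r \<le> 0" using AA unfolding r by (simp add: mult_le_0_iff)
  have "T \<bullet> (X2 - Q) < 0"
    using polar_less_1_interior[OF T(1) X2] T(2) by (simp add: inner_diff_right)
  then have "r * (T \<bullet> (\<i> * A)) < 0" unfolding r by simp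
  with \<open>r \<le> 0\<close> have pos: "0 < T \<bullet> (\<i> * A)" by (simp add: mult_less_0_iff)
  have "Q \<noteq> 0" using AQ by auto
  have "(T - A) \<bullet> Q = 0" using AQ T by (simp add: inner_diff_left)
  then obtain s where s: "T - A = s *\<^sub>R (\<i> * Q)"
    using orthogonal_iff_multiple_ii[OF \<open>Q \<noteq> 0\<close>] by blast
  have "T \<bullet> (\<i> * A) = (T - A) \<bullet> (\<i> * A)" by (simp add: inner_diff_left)
  also have "\<dots> = s" unfolding s using AQ by (simp add: inner_commute)
  finally have "0 \<le> s" using pos by simp
  moreover have "T = A + s *\<^sub>R (\<i> * Q)" using s by (simp add: algebra_simps)
  ultimately show ?thesis using right_tangentI[OF Qc AQ T] that by blast
qed

section \<open>Invariance under a single collision\<close>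

text \<open>If the ray from \<open>Q\<close> in the direction \<open>w\<close> missed the interior, a line would separate the two.
  This line supports the table at \<open>Q\<close>, so it is the tangent line \<open>{X. T \<bullet> X = 1}\<close>, and \<open>w\<close>
  would not point to the side of the table.\<close>
lemma inward_directions:
  assumes Q: "Q \<in> path_image \<gamma>" and T: "T \<in> polar table" "T \<bullet> Q = 1" and w: "w \<bullet> T < 0"
  obtains e where "0 < e" "\<And>s. 0 < s \<Longrightarrow> s \<le> e \<Longrightarrow> Q + s *\<^sub>R w \<in> inside (path_image \<gamma>)"
proof -
  have Qt: "Q \<in> table" "Q \<notin> interior table"
    using Q curve_subset_table frontier_table by (auto simp: frontier_def)
  have "\<exists>e>0. Q + e *\<^sub>R w \<in> interior table"
  proof (rule ccontr)
    assume no: "\<not> ?thesis"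
    define C where "C = (\<lambda>s. Q + s *\<^sub>R w) ` {0..}"
    have "convex C"
    proof -
      have "C = (+) Q ` (\<lambda>s. s *\<^sub>R w) ` {0..}"
        by (auto simp: C_def image_image)
      then show ?thesis
        by (auto intro!: convex_translation convex_linear_image bounded_linear.linear
            bounded_linear_scaleR_left)
    qed
    moreover have "interior table \<inter> C = {}"
      using no Qt(2) by (force simp: C_def le_less)
    ultimately obtain Y where Y: "Y \<in> polar table" "\<And>X. X \<in> C \<Longrightarrow> 1 \<le> Y \<bullet> X"
      using polar_separates[OF convex_table zero_interior_table, of C] by (auto simp: C_def)
    have "Q \<in> C" "Q + w \<in> C"
      unfolding C_def by (rule image_eqI[of _ _ 0], simp_all) (rule image_eqI[of _ _ 1], simp_all)
    then have "1 \<le> Y \<bullet> Q" "1 \<le> Y \<bullet> Q + Y \<bullet> w"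
      using Y(2) by (auto simp: inner_add_right[symmetric])
    moreover have "Y \<bullet> Q \<le> 1"
      using Y(1) Qt polarD by blast
    ultimately have "Y \<bullet> Q = 1" "0 \<le> Y \<bullet> w" by auto
    then show False
      using polar_functional_unique[OF Qt(1) Y(1) _ T] w by (simp add: inner_commute)
  qed
  then obtain e where e: "0 < e" "Q + e *\<^sub>R w \<in> interior table" by blast
  have "Q + s *\<^sub>R w \<in> inside (path_image \<gamma>)" if "0 < s" "s \<le> e" for s
  proof -
    have "Q - (s / e) *\<^sub>R (Q - (Q + e *\<^sub>R w)) \<in> interior table"
      using e that Qt closure_subset
      by (intro mem_interior_closure_convex_shrink[OF convex_table]) auto
    then show ?thesis
      using e by (simp add: interior_table)
  qed
  with e(1) show ?thesis using that by blast
qed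

lemma outward_normalI:
  assumes "T \<in> polar table" "T \<bullet> Q = 1" "Q \<in> path_image \<gamma>"
  shows "outward_normal \<gamma> Q ((1 / norm T) *\<^sub>R T)"
proof -
  obtain t where t: "Q = \<gamma> t" using assms(3) by (auto simp: path_image_def)
  have "T \<noteq> 0" using assms by auto
  have "Q + s *\<^sub>R ((1 / norm T) *\<^sub>R T) \<in> outside (path_image \<gamma>)" if "0 < s" for s
  proof (rule outside_if_not_table)
    have "T \<bullet> (Q + s *\<^sub>R ((1 / norm T) *\<^sub>R T)) = 1 + s * norm T"
      using assms \<open>T \<noteq> 0\<close> by (simp add: inner_add_right dot_square_norm power2_eq_square)
    also have "\<dots> > 1" using that \<open>T \<noteq> 0\<close> by simp
    finally show "Q + s *\<^sub>R ((1 / norm T) *\<^sub>R T) \<notin> table"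
      using assms(1) polarD by force
  qed
  then have "\<forall>\<^sub>F s in at_right 0. Q + s *\<^sub>R ((1 / norm T) *\<^sub>R T) \<in> outside (path_image \<gamma>)"
    by (intro eventually_at_rightI[of 0 1]) auto
  then show ?thesis
    using t assms \<open>T \<noteq> 0\<close> polar_orthogonal_tangent[of T t]
    unfolding outward_normal_def by (intro exI[of _ t]) auto
qed

text \<open>The flow is only observed at interior points. So the collision at \<open>Q\<close> is embedded in a short
  orbit, from \<open>Q - e2 *\<^sub>R v\<close> to \<open>Q + e1 *\<^sub>R v'\<close>, and the values at its ends are carried to \<open>Q\<close> by
  invariance under free motion.\<close>
lemma reflection_invariance:
  assumes f: "billiard_integral \<gamma> f" and free: "\<And>q v s. f (q + s *\<^sub>R v) v = f q v"
    and Q: "Q \<in> path_image \<gamma>" and T: "T \<in> polar table" "T \<bullet> Q = 1"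
    and v: "norm v = 1" "0 < v \<bullet> T"
  shows "f Q (v - (2 * (v \<bullet> T) / (T \<bullet> T)) *\<^sub>R T) = f Q v"
proof -
  define \<nu> where "\<nu> = (1 / norm T) *\<^sub>R T"
  define v' where "v' = v - (2 * (v \<bullet> \<nu>)) *\<^sub>R \<nu>"
  have "T \<noteq> 0" using T by auto
  have v': "v' = v - (2 * (v \<bullet> T) / (T \<bullet> T)) *\<^sub>R T"
    by (simp add: v'_def \<nu>_def dot_square_norm power2_eq_square)
  have "v' \<bullet> T = - (v \<bullet> T)"
    unfolding v' using \<open>T \<noteq> 0\<close> by (simp add: inner_diff_left)
  then have neg: "v' \<bullet> T < 0" "(- v) \<bullet> T < 0" using v by auto
  obtain e1 where e1: "0 < e1" "\<And>s. 0 < s \<Longrightarrow> s \<le> e1 \<Longrightarrow> Q + s *\<^sub>R v' \<in> inside (path_image \<gamma>)"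
    using inward_directions[OF Q T neg(1)] by blast
  obtain e2 where e2: "0 < e2" "\<And>s. 0 < s \<Longrightarrow> s \<le> e2 \<Longrightarrow> Q + s *\<^sub>R (- v) \<in> inside (path_image \<gamma>)"
    using inward_directions[OF Q T neg(2)] by blast
  define q where "q = Q - e2 *\<^sub>R v"
  have qQ: "q + e2 *\<^sub>R v = Q" by (simp add: q_def)
  have seg: "q + s *\<^sub>R v \<in> inside (path_image \<gamma>)" if "0 < s" "s < e2" for s
    using e2(2)[of "e2 - s"] that by (simp add: q_def algebra_simps)
  have "billiard_flow \<gamma> e1 Q v' (Q + e1 *\<^sub>R v') v'"
    using e1 by (intro billiard_flow.free) auto
  then have "billiard_flow \<gamma> (e2 + e1) q v (Q + e1 *\<^sub>R v') v'"
    using seg e2(1) Q outward_normalI[OF T Q]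
    by (intro billiard_flow.collision[where \<nu> = \<nu>]) (auto simp: qQ \<nu>_def v'_def)
  moreover have "q \<in> inside (path_image \<gamma>)" using e2 by (simp add: q_def)
  moreover have "Q + e1 *\<^sub>R v' \<in> inside (path_image \<gamma>)" using e1 by simp
  ultimately have "f (Q + e1 *\<^sub>R v') v' = f q v"
    using f v(1) unfolding billiard_integral_def by blast
  then have "f Q v' = f Q v"
    using free[of q e2 v] by (simp add: free qQ)
  then show ?thesis by (simp add: v')
qed

text \<open>Evenness allows \<open>v\<close> to be replaced by \<open>- v\<close>, so that the particle approaches the boundary. A
  tangent vector is its own reflection.\<close>
lemma reflection_invariance_even:
  assumes f: "billiard_integral \<gamma> f" and free: "\<And>q v s. f (q + s *\<^sub>R v) v = f q v"
    and even: "\<And>q v. f q (- v) = f q v"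
    and Q: "Q \<in> path_image \<gamma>" and T: "T \<in> polar table" "T \<bullet> Q = 1"
    and v: "norm v = 1"
  shows "f Q (v - (2 * (v \<bullet> T) / (T \<bullet> T)) *\<^sub>R T) = f Q v"
proof -
  consider "0 < v \<bullet> T" | "v \<bullet> T = 0" | "0 < (- v) \<bullet> T" by fastforce
  then show ?thesis
  proof cases
    case 3
    have "f Q (- v - (2 * ((- v) \<bullet> T) / (T \<bullet> T)) *\<^sub>R T) = f Q (- v)"
      by (rule reflection_invariance[OF f free Q T _ 3]) (use v in simp)
    moreover have "- v - (2 * ((- v) \<bullet> T) / (T \<bullet> T)) *\<^sub>R T = - (v - (2 * (v \<bullet> T) / (T \<bullet> T)) *\<^sub>R T)"
      by simp
    ultimately show ?thesis by (simp only: even)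
  qed (use reflection_invariance[OF f free Q T v] in simp_all)
qed

section \<open>The angular billiard map in dual terms\<close>

text \<open>Otherwise the tangent would meet \<open>\<Gamma>\<close> in two points, and \<open>\<Gamma>\<close> is strictly convex.\<close>
lemma right_tangent_point_on_dual_curve:
  assumes rt: "right_tangent (dual_curve \<gamma>) A u T" and A: "A \<in> polar table"
  shows "T = A"
proof -
  obtain Q where Q: "Q \<in> path_image \<gamma>" "A \<bullet> Q = 1" "T \<bullet> Q = 1"
    using right_tangent_dual[OF rt] by metis
  have "T \<in> polar table" using rt by (auto simp: right_tangent_def dual_curve_iff)
  then show ?thesis
    using polar_functional_unique Q A curve_subset_table by blast
qed

text \<open>Of two right tangents from the same point off \<open>\<Gamma>\<close>, each has the tangency point of the other
  on its left side. This excludes a turn from the one direction to the other.\<close>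
lemma right_tangent_unique:
  assumes rt1: "right_tangent (dual_curve \<gamma>) A u1 T1" and rt2: "right_tangent (dual_curve \<gamma>) A u2 T2"
    and A: "A \<notin> polar table"
  shows "u1 = u2" "T1 = T2"
proof -
  have T: "T1 \<in> polar table" "T2 \<in> polar table"
    using rt1 rt2 by (auto simp: right_tangent_def dual_curve_iff)
  have key: "0 \<le> (\<i> * Q) \<bullet> Q'"
    if rt': "right_tangent (dual_curve \<gamma>) A u' T'" and u': "u' = (1 / norm Q') *\<^sub>R (\<i> * Q')"
      and Q: "Q \<in> path_image \<gamma>" "A \<bullet> Q = 1" and nz: "Q' \<noteq> 0" for Q Q' u' T'
  proof -
    obtain s where s: "T' \<in> dual_curve \<gamma>" "0 \<le> s" "T' = A + s *\<^sub>R u'"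
      using rt' unfolding right_tangent_def by blast
    then have "T' \<in> polar table" by (simp add: dual_curve_iff)
    then have "T' \<noteq> A" "T' \<bullet> Q \<le> 1"
      using A Q(1) polarD curve_subset_table by blast+
    then have "0 < s" "s * (u' \<bullet> Q) \<le> 0"
      using s Q(2) by (auto simp: inner_add_left less_le)
    then have "u' \<bullet> Q \<le> 0" by (simp add: mult_le_0_iff)
    then have "(\<i> * Q') \<bullet> Q \<le> 0"
      using nz by (simp add: u' divide_le_0_iff)
    then show ?thesis by (simp add: inner_complex_def mult.commute)
  qed
  obtain Q1 where Q1: "Q1 \<in> path_image \<gamma>" "A \<bullet> Q1 = 1" "T1 \<bullet> Q1 = 1" "u1 = (1 / norm Q1) *\<^sub>R (\<i> * Q1)"
    using right_tangent_dual[OF rt1] by metis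
  obtain Q2 where Q2: "Q2 \<in> path_image \<gamma>" "A \<bullet> Q2 = 1" "T2 \<bullet> Q2 = 1" "u2 = (1 / norm Q2) *\<^sub>R (\<i> * Q2)"
    using right_tangent_dual[OF rt2] by metis
  have nz: "Q1 \<noteq> 0" "Q2 \<noteq> 0" "A \<noteq> 0" using Q1 Q2 by auto
  have "0 \<le> (\<i> * Q1) \<bullet> Q2" "0 \<le> (\<i> * Q2) \<bullet> Q1"
    using key[OF rt2 Q2(4) Q1(1,2) nz(2)] key[OF rt1 Q1(4) Q2(1,2) nz(1)] by auto
  moreover have "(\<i> * Q2) \<bullet> Q1 = - ((\<i> * Q1) \<bullet> Q2)" by (simp add: inner_complex_def)
  ultimately have "(\<i> * Q1) \<bullet> Q2 = 0" by simp
  then have "Q2 \<bullet> (\<i> * Q1) = 0" by (simp add: inner_commute)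
  then obtain c where "Q2 = c *\<^sub>R (\<i> * (\<i> * Q1))"
    using orthogonal_iff_multiple_ii[of "\<i> * Q1" Q2] nz by auto
  then have c: "Q2 = - (c *\<^sub>R Q1)" by simp
  have "c = - 1" using Q1(2) Q2(2) unfolding c by simp
  then have "Q1 = Q2" using c by simp
  then show "u1 = u2" using Q1 Q2 by simp
  show "T1 = T2"
    using polar_functional_unique T Q1 Q2 \<open>Q1 = Q2\<close> curve_subset_table by blast
qed

text \<open>Singular points are those whose reflected billiard line passes through \<open>O\<close>, and so has no
  dual point.\<close>
lemma tangent_direction_in_sym_line_iff:
  assumes "T \<noteq> 0" "A \<bullet> Q = 1"
  shows "(1 / norm Q) *\<^sub>R (\<i> * Q) \<in> sym_line A T \<longleftrightarrow> line_reflection T A \<bullet> Q = 0"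
proof -
  let ?R = "line_reflection T A"
  have nz: "Q \<noteq> 0" "A \<noteq> 0" using assms by auto
  then have "?R \<noteq> 0" using norm_line_reflection[OF assms(1), of A] by auto
  show ?thesis
  proof
    assume "(1 / norm Q) *\<^sub>R (\<i> * Q) \<in> sym_line A T"
    then obtain k where k: "(1 / norm Q) *\<^sub>R (\<i> * Q) = k *\<^sub>R ?R"
      by (auto simp: sym_line_eq_span span_singleton)
    then have "k \<noteq> 0" using nz by auto
    have "k * (?R \<bullet> Q) = ((1 / norm Q) *\<^sub>R (\<i> * Q)) \<bullet> Q" unfolding k by simp
    then show "?R \<bullet> Q = 0" using \<open>k \<noteq> 0\<close> by simp
  next
    assume "?R \<bullet> Q = 0"
    then obtain s where s: "?R = s *\<^sub>R (\<i> * Q)"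
      using orthogonal_iff_multiple_ii[OF nz(1)] by blast
    then have "s \<noteq> 0" using \<open>?R \<noteq> 0\<close> by auto
    then have "(1 / norm Q) *\<^sub>R (\<i> * Q) = (1 / (norm Q * s)) *\<^sub>R ?R" unfolding s by simp
    then show "(1 / norm Q) *\<^sub>R (\<i> * Q) \<in> sym_line A T"
      by (auto simp: sym_line_eq_span span_singleton)
  qed
qed

lemma meet_sym_line_iff:
  assumes "A \<bullet> Q = 1" "line_reflection T A \<bullet> Q \<noteq> 0"
  shows "B \<in> sym_line A T \<and> (\<exists>s. B = A + s *\<^sub>R ((1 / norm Q) *\<^sub>R (\<i> * Q))) \<longleftrightarrow>
    B = (1 / (line_reflection T A \<bullet> Q)) *\<^sub>R line_reflection T A"
    (is "?l \<longleftrightarrow> B = ?B")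
proof
  have nz: "Q \<noteq> 0" using assms by auto
  {
    assume ?l
    then obtain k s where B: "B = k *\<^sub>R line_reflection T A"
      "B = A + s *\<^sub>R ((1 / norm Q) *\<^sub>R (\<i> * Q))"
      unfolding sym_line_eq_span span_singleton by blast
    have "B \<bullet> Q = 1" using assms(1) by (simp add: B(2) inner_add_left)
    then have "k * (line_reflection T A \<bullet> Q) = 1" by (simp add: B(1))
    then show "B = ?B" using assms(2) B(1) by (simp add: field_simps)
  }
  assume B: "B = ?B"
  then have "B \<in> sym_line A T" by (auto simp: sym_line_eq_span span_singleton)
  have "(B - A) \<bullet> Q = 0" using assms B by (simp add: inner_diff_left)
  then obtain s where s: "B - A = s *\<^sub>R (\<i> * Q)"
    using orthogonal_iff_multiple_ii[OF nz] by blast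
  then have "B = A + (s * norm Q) *\<^sub>R ((1 / norm Q) *\<^sub>R (\<i> * Q))"
    using nz by (simp add: algebra_simps)
  with \<open>B \<in> sym_line A T\<close> show ?l by blast
qed

text \<open>If \<open>A\<close> lies off \<open>\<Gamma>\<close>, the right tangent is unique. If \<open>A\<close> lies on \<open>\<Gamma>\<close>, every admissible
  \<open>T\<close> is \<open>A\<close> itself, and the map fixes \<open>A\<close>. So the definite description has a unique witness in
  both cases.\<close>
lemma angular_map_dual:
  assumes A: "A \<notin> inside (dual_curve \<gamma>)" "A \<notin> singular_set (dual_curve \<gamma>)"
  obtains Q T where "Q \<in> path_image \<gamma>" "A \<bullet> Q = 1" "T \<in> polar table" "T \<bullet> Q = 1"
    "line_reflection T A \<bullet> Q \<noteq> 0"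
    "angular_map (dual_curve \<gamma>) A = (1 / (line_reflection T A \<bullet> Q)) *\<^sub>R line_reflection T A"
proof -
  let ?rt = "right_tangent (dual_curve \<gamma>) A"
  let ?meet = "\<lambda>u T B. B \<in> sym_line A T \<and> (\<exists>s. B = A + s *\<^sub>R u)"
  have dual: "\<exists>Q. Q \<in> path_image \<gamma> \<and> A \<bullet> Q = 1 \<and> T \<in> polar table \<and> T \<bullet> Q = 1 \<and>
      line_reflection T A \<bullet> Q \<noteq> 0 \<and>
      (\<forall>B. ?meet u T B \<longleftrightarrow> B = (1 / (line_reflection T A \<bullet> Q)) *\<^sub>R line_reflection T A)"
    if rt: "?rt u T" for u T
  proof -
    obtain Q where Q: "Q \<in> path_image \<gamma>" "A \<bullet> Q = 1" "T \<bullet> Q = 1" "u = (1 / norm Q) *\<^sub>R (\<i> * Q)"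
      using right_tangent_dual[OF rt] by metis
    have T: "T \<in> polar table" using rt by (auto simp: right_tangent_def dual_curve_iff)
    have "T \<noteq> 0" using Q by auto
    have "u \<notin> sym_line A T" using A rt by (auto simp: singular_set_def)
    then have "line_reflection T A \<bullet> Q \<noteq> 0"
      using tangent_direction_in_sym_line_iff[OF \<open>T \<noteq> 0\<close> Q(2)] Q(4) by simp
    with meet_sym_line_iff[OF Q(2) this] Q T show ?thesis by blast
  qed
  obtain u T where rt: "?rt u T" using right_tangent_ex[OF A(1)] by blast
  obtain Q where Q: "Q \<in> path_image \<gamma>" "A \<bullet> Q = 1" "T \<in> polar table" "T \<bullet> Q = 1"
    "line_reflection T A \<bullet> Q \<noteq> 0"
    and meet: "\<And>B. ?meet u T B \<longleftrightarrow> B = (1 / (line_reflection T A \<bullet> Q)) *\<^sub>R line_reflection T A"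
    using dual[OF rt] by blast
  let ?B = "(1 / (line_reflection T A \<bullet> Q)) *\<^sub>R line_reflection T A"
  have "angular_map (dual_curve \<gamma>) A = ?B"
    unfolding angular_map_def
  proof (rule the_equality)
    show "\<exists>u T. ?rt u T \<and> ?meet u T ?B" using rt meet by blast
    fix B assume "\<exists>u T. ?rt u T \<and> ?meet u T B"
    then obtain u' T' where rt': "?rt u' T'" and m: "?meet u' T' B" by blast
    show "B = ?B"
    proof (cases "A \<in> polar table")
      case True
      have "T = A" "T' = A" using right_tangent_point_on_dual_curve True rt rt' by blast+
      moreover have "A \<noteq> 0" using Q by auto
      then have "line_reflection A A = A"
        by (simp add: line_reflection_def) (metis add_diff_cancel_right' mult_2 scaleR_2)
      moreover obtain Q' where "A \<bullet> Q' = 1"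
        "B = (1 / (line_reflection T' A \<bullet> Q')) *\<^sub>R line_reflection T' A"
        using dual[OF rt'] m by blast
      ultimately show ?thesis using Q(2) by simp
    next
      case False
      then show ?thesis using right_tangent_unique[OF rt rt'] m meet by blast
    qed
  qed
  then show ?thesis using that Q by blast
qed

end

section \<open>The dual integral\<close>

lemma momentum_ii: "momentum q (\<i> * a) = q \<bullet> a"
  by (simp add: momentum_def inner_complex_def)

lemma momentum_free_flow: "momentum (q + s *\<^sub>R v) v = momentum q v"
  by (simp add: momentum_def algebra_simps)

text \<open>Here \<open>c *\<^sub>R (\<i> * A)\<close> is a velocity along the line dual to \<open>A\<close>, which passes through \<open>Q\<close>.
  This is where the value of \<open>\<Phi>\<close> on a billiard orbit is expressed through the dual point.\<close>
lemma eval3_momentum_dual: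
  assumes h: "homogeneous3 n \<Phi>" and "A \<bullet> Q = 1"
  shows "eval3 \<Phi> (momentum Q (c *\<^sub>R (\<i> * A))) (Re (c *\<^sub>R (\<i> * A))) (Im (c *\<^sub>R (\<i> * A)))
    = c ^ n * eval3 \<Phi> 1 (- Im A) (Re A)"
proof -
  have "momentum Q (c *\<^sub>R (\<i> * A)) = c * 1"
    using momentum_ii[of Q "c *\<^sub>R A"] assms(2) by (simp add: inner_commute)
  moreover have "Re (c *\<^sub>R (\<i> * A)) = c * - Im A" "Im (c *\<^sub>R (\<i> * A)) = c * Re A" by simp_all
  ultimately show ?thesis
    by (simp only: eval3_homogeneous[OF h])
qed

theorem theorem3:
  fixes \<gamma> :: "real \<Rightarrow> complex" and \<Phi> :: "nat \<times> nat \<times> nat \<Rightarrow>\<^sub>0 real" and n :: nat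
  assumes "convex_closed_curve \<gamma>"
    and "0 \<in> inside (path_image \<gamma>)"
    and "even n"
    and "homogeneous3 n \<Phi>"
    and "billiard_integral \<gamma> (\<lambda>q v. eval3 \<Phi> (momentum q v) (Re v) (Im v))"
    and "vanishes_on_tangents \<gamma> (\<lambda>q v. eval3 \<Phi> (momentum q v) (Re v) (Im v))"
  shows "\<exists>F :: nat \<times> nat \<Rightarrow>\<^sub>0 real.
    (\<forall>x y. eval2 F x y = eval3 \<Phi> 1 (- y) x) \<and>
    total_degree2 F \<le> n \<and> (fst_var_not_dvd3 \<Phi> \<longrightarrow> total_degree2 F = n) \<and>
    angular_integral (dual_curve \<gamma>)
      (\<lambda>A. eval2 F (Re A) (Im A) / (sqrt ((Re A)\<^sup>2 + (Im A)\<^sup>2)) ^ n) \<and>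
    (\<forall>A \<in> dual_curve \<gamma>. eval2 F (Re A) (Im A) = 0)"
proof (intro exI conjI impI allI ballI)
  interpret billiard_table \<gamma> by unfold_locales fact+
  let ?F = "dual_poly n \<Phi>"
  let ?f = "\<lambda>q v. eval3 \<Phi> (momentum q v) (Re v) (Im v)"
  note dual_value = eval3_momentum_dual[OF assms(4)]
  show F: "eval2 ?F x y = eval3 \<Phi> 1 (- y) x" for x y
    by (rule eval2_dual_poly[OF assms(4)])
  show "total_degree2 ?F \<le> n" "fst_var_not_dvd3 \<Phi> \<Longrightarrow> total_degree2 ?F = n"
    using total_degree2_dual_poly[OF assms(4)] by blast+
  show "eval2 ?F (Re A) (Im A) = 0" if A: "A \<in> dual_curve \<gamma>" for A
  proof -
    obtain t where t: "A \<in> polar table" "A \<bullet> \<gamma> t = 1"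
      using A dual_curve_iff by (auto simp: path_image_def)
    have "A \<noteq> 0" using t by auto
    let ?v = "(1 / norm A) *\<^sub>R (\<i> * A)"
    have "vector_derivative \<gamma> (at t) \<bullet> A = 0"
      using polar_orthogonal_tangent[OF t] by (simp add: inner_commute)
    then obtain s where s: "vector_derivative \<gamma> (at t) = s *\<^sub>R (\<i> * A)"
      using orthogonal_iff_multiple_ii[OF \<open>A \<noteq> 0\<close>] by blast
    have "s \<noteq> 0" using s tangent_nonzero by (metis scaleR_zero_left)
    then have "?v = (1 / (norm A * s)) *\<^sub>R vector_derivative \<gamma> (at t)" unfolding s by simp
    then have "?v \<in> span {vector_derivative \<gamma> (at t)}" by (auto simp: span_singleton)
    moreover have "norm ?v = 1" using \<open>A \<noteq> 0\<close> by (simp add: norm_mult)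
    ultimately have "?f (\<gamma> t) ?v = 0"
      using assms(6) unfolding vanishes_on_tangents_def by blast
    then show ?thesis
      using dual_value[OF t(2), of "1 / norm A"] \<open>A \<noteq> 0\<close> by (simp only: F) simp
  qed
  show "angular_integral (dual_curve \<gamma>)
      (\<lambda>A. eval2 ?F (Re A) (Im A) / (sqrt ((Re A)\<^sup>2 + (Im A)\<^sup>2)) ^ n)"
    unfolding angular_integral_def F cmod_def[symmetric]
  proof
    fix A assume "A \<in> - inside (dual_curve \<gamma>) - singular_set (dual_curve \<gamma>)"
    then have "A \<notin> inside (dual_curve \<gamma>)" "A \<notin> singular_set (dual_curve \<gamma>)" by auto
    from angular_map_dual[OF this] obtain Q T where
      QT: "Q \<in> path_image \<gamma>" "A \<bullet> Q = 1" "T \<in> polar table" "T \<bullet> Q = 1"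
      and nz: "line_reflection T A \<bullet> Q \<noteq> 0"
      and B: "angular_map (dual_curve \<gamma>) A = (1 / (line_reflection T A \<bullet> Q)) *\<^sub>R line_reflection T A"
      by metis
    have nz': "T \<noteq> 0" "A \<noteq> 0" using QT by auto
    (* The image point B is dual to the reflected line: the reflected unit velocity is ?c times the
       quarter turn of B, and the even power removes the sign of ?c. *)
    define B where "B = (1 / (line_reflection T A \<bullet> Q)) *\<^sub>R line_reflection T A"
    let ?c = "(line_reflection T A \<bullet> Q) / norm A"
    have BQ: "B \<bullet> Q = 1" using nz by (simp add: B_def)
    have nB: "norm B = norm A / \<bar>line_reflection T A \<bullet> Q\<bar>"
      using norm_line_reflection[OF nz'(1)] by (simp add: B_def)
    let ?v = "(1 / norm A) *\<^sub>R (\<i> * A)"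
    have refl: "?v - (2 * (?v \<bullet> T) / (T \<bullet> T)) *\<^sub>R T = ?c *\<^sub>R (\<i> * B)"
    proof -
      have "?v - (2 * (?v \<bullet> T) / (T \<bullet> T)) *\<^sub>R T = (1 / norm A) *\<^sub>R (\<i> * line_reflection T A)"
        using reflect_ii[OF nz'(1), of "(1 / norm A) *\<^sub>R A"] by (simp add: line_reflection_scaleR)
      then show ?thesis using nz by (simp add: B_def)
    qed
    have "?f Q (?v - (2 * (?v \<bullet> T) / (T \<bullet> T)) *\<^sub>R T) = ?f Q ?v"
    proof (rule reflection_invariance_even[OF assms(5) _ _ QT(1,3,4)])
      show "?f (q + s *\<^sub>R v) v = ?f q v" for q v s by (simp only: momentum_free_flow)
      show "?f q (- v) = ?f q v" for q v
        using eval3_homogeneous[OF assms(4), of "- 1" "momentum q v" "Re v" "Im v"] \<open>even n\<close>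
        by (simp add: momentum_def)
      show "norm ?v = 1" using nz' by (simp add: norm_mult)
    qed
    then have "?c ^ n * eval3 \<Phi> 1 (- Im B) (Re B) = (1 / norm A) ^ n * eval3 \<Phi> 1 (- Im A) (Re A)"
      unfolding refl dual_value[OF BQ] dual_value[OF QT(2)] .
    moreover have "?c ^ n = \<bar>?c\<bar> ^ n" by (simp only: power_even_abs[OF \<open>even n\<close>])
    moreover have "\<bar>?c\<bar> = 1 / norm B" using nz nz' by (simp add: nB abs_divide)
    ultimately have "(1 / norm B) ^ n * eval3 \<Phi> 1 (- Im B) (Re B) =
        (1 / norm A) ^ n * eval3 \<Phi> 1 (- Im A) (Re A)"
      by simp
    then show "eval3 \<Phi> 1 (- Im A) (Re A) / cmod A ^ n =
        eval3 \<Phi> 1 (- Im (angular_map (dual_curve \<gamma>) A)) (Re (angular_map (dual_curve \<gamma>) A)) /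
        cmod (angular_map (dual_curve \<gamma>) A) ^ n"
      unfolding B B_def[symmetric] by (simp add: power_inverse divide_inverse mult.commute)
  qed
qed

end
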